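(* Let $K$ be an algebraically closed field of characteristic $0$ and let $\Gamma\colon A=A_0\oplus A_1$ be a $\mathbb Z_2$-graded regular $K$-algebra whose regular decomposition is minimal. Then $A$ satisfies the primeness property for (ordinary) central polynomials.
   Context: Algebras are associative. For a finite abelian group $G$, a $G$-grading $A=\bigoplus_{g\in G}A_g$ (with $A_gA_h\subseteq A_{g+h}$) is regular if (i) for every $n\in\mathbb N$ and $(g_1,\dots,g_n)\in G^n$ there exist $a_i\in A_{g_i}$ with $a_1\cdots a_n\neq 0$; and (ii) for every $g,h\in G$ there is a scalar $\beta(g,h)\in K^*$, depending only on $g,h$, such that $a_ga_h=\beta(g,h)a_ha_g$ for all $a_g\in A_g$, $a_h\in A_h$. The regular decomposition is minimal if there are no $g\neq h$ in $G$ with $\beta(g,x)=\beta(h,x)$ for all $x\in G$. $K\langle X\rangle$ is the free unitary associative algebra on a countably infinite set $X$ of variables. A polynomial $f\in K\langle X\rangle$ is a central polynomial of an algebra $R$ if all its values on $R$ lie in the centre of $R$; it is proper if it is not a polynomial identity of $R$. $R$ satisfies the primeness property for central polynomials if, whenever $f,g\in K\langle X\rangle$ are polynomials in disjoint sets of variables such that $fg$ is a proper central polynomial of $R$, both $f$ and $g$ are central polynomials of $R$. *)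

theory Defs
  imports
    "HOL-Library.Poly_Mapping"
    "HOL-Library.Numeral_Type"
    "HOL-Computational_Algebra.Polynomial"
begin

datatype 'x monomial = Monomial (letters: "'x list")

instantiation monomial :: (type) monoid_add
begin

definition zero_monomial :: "'a monomial"
  where "0 = Monomial []"

definition plus_monomial :: "'a monomial \<Rightarrow> 'a monomial \<Rightarrow> 'a monomial"
  where "u + v = Monomial (letters u @ letters v)"

instance
  by standard (simp_all add: zero_monomial_def plus_monomial_def)

end

text \<open>
  The monomials form the free monoid under concatenation, written additively so that the
  convolution product on \<^typ>\<open>'m \<Rightarrow>\<^sub>0 'k\<close> is the product of the free unitary associative
  algebra in the countably infinitely many variables \<^typ>\<open>nat\<close>.
\<close>

type_synonym 'k free_algebra = "nat monomial \<Rightarrow>\<^sub>0 'k"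

definition variables :: "'k::zero free_algebra \<Rightarrow> nat set"
  where "variables f = (\<Union>w\<in>Poly_Mapping.keys f. set (letters w))"

text \<open>
  An algebra is a subset \<open>A\<close> of a unital \<open>K\<close>-algebra \<^typ>\<open>'a\<close> that is closed under the algebra
  operations. It need not contain the ambient unit: every algebra, unital or not, is of this form
  (take \<open>A = UNIV\<close> if it is unital, and its unitization as the ambient algebra otherwise). The
  ambient unit serves to evaluate constant terms.
\<close>

locale algebra_over_field = vector_space scale
  for scale :: "'k::field \<Rightarrow> 'a::ring_1 \<Rightarrow> 'a" +
  assumes scale_mult_left: "scale c x * y = scale c (x * y)"
    and scale_mult_right: "x * scale c y = scale c (x * y)"
begin

definition subalgebra :: "'a set \<Rightarrow> bool"
  where "subalgebra A \<longleftrightarrow> subspace A \<and> (\<forall>x\<in>A. \<forall>y\<in>A. x * y \<in> A)"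

definition is_grading :: "'a set \<Rightarrow> ('g::{finite,ab_group_add} \<Rightarrow> 'a set) \<Rightarrow> bool"
  where "is_grading A \<Gamma> \<longleftrightarrow>
    (\<forall>g. subspace (\<Gamma> g) \<and> \<Gamma> g \<subseteq> A) \<and>
    (\<forall>a\<in>A. \<exists>!x. (\<forall>g. x g \<in> \<Gamma> g) \<and> a = (\<Sum>g\<in>UNIV. x g)) \<and>
    (\<forall>g h. \<forall>a\<in>\<Gamma> g. \<forall>b\<in>\<Gamma> h. a * b \<in> \<Gamma> (g + h))"

definition regular_grading ::
    "'a set \<Rightarrow> ('g::{finite,ab_group_add} \<Rightarrow> 'a set) \<Rightarrow> ('g \<Rightarrow> 'g \<Rightarrow> 'k) \<Rightarrow> bool"
  where "regular_grading A \<Gamma> \<beta> \<longleftrightarrow>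
    is_grading A \<Gamma> \<and>
    (\<forall>gs. gs \<noteq> [] \<longrightarrow> (\<exists>as. list_all2 (\<lambda>g a. a \<in> \<Gamma> g) gs as \<and> prod_list as \<noteq> 0)) \<and>
    (\<forall>g h. \<beta> g h \<noteq> 0 \<and> (\<forall>a\<in>\<Gamma> g. \<forall>b\<in>\<Gamma> h. a * b = scale (\<beta> g h) (b * a)))"

definition eval :: "(nat \<Rightarrow> 'a) \<Rightarrow> 'k free_algebra \<Rightarrow> 'a"
  where "eval a f =
    (\<Sum>w\<in>Poly_Mapping.keys f. scale (Poly_Mapping.lookup f w) (prod_list (map a (letters w))))"

text \<open>
  The values of polynomials with a constant term lie in \<open>K 1 + A\<close>, which is \<open>A\<close> itself
  if \<open>1 \<in> A\<close>.
\<close>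

definition unital_hull :: "'a set \<Rightarrow> 'a set"
  where "unital_hull A = {scale c 1 + a | c a. a \<in> A}"

lemma unital_hull_eq:
  assumes "subalgebra A" and "1 \<in> A"
  shows "unital_hull A = A"
proof
  have sub: "subspace A"
    using assms(1) by (simp add: subalgebra_def)
  show "unital_hull A \<subseteq> A"
    using sub assms(2) by (auto simp: unital_hull_def intro!: subspace_add subspace_scale)
  show "A \<subseteq> unital_hull A"
  proof
    fix a assume "a \<in> A"
    moreover have "a = scale 0 1 + a" by simp
    ultimately show "a \<in> unital_hull A" unfolding unital_hull_def by blast
  qed
qed

definition centre :: "'a set \<Rightarrow> 'a set"
  where "centre R = {z \<in> R. \<forall>r\<in>R. z * r = r * z}"

definition central_polynomial :: "'a set \<Rightarrow> 'k free_algebra \<Rightarrow> bool"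
  where "central_polynomial A f \<longleftrightarrow> (\<forall>a. range a \<subseteq> A \<longrightarrow> eval a f \<in> centre (unital_hull A))"

definition polynomial_identity :: "'a set \<Rightarrow> 'k free_algebra \<Rightarrow> bool"
  where "polynomial_identity A f \<longleftrightarrow> (\<forall>a. range a \<subseteq> A \<longrightarrow> eval a f = 0)"

definition proper_central_polynomial :: "'a set \<Rightarrow> 'k free_algebra \<Rightarrow> bool"
  where "proper_central_polynomial A f \<longleftrightarrow> central_polynomial A f \<and> \<not> polynomial_identity A f"

definition central_primeness_property :: "'a set \<Rightarrow> bool"
  where "central_primeness_property A \<longleftrightarrow>
    (\<forall>f g. variables f \<inter> variables g = {} \<and> proper_central_polynomial A (f * g) \<longrightarrow>
      central_polynomial A f \<and> central_polynomial A g)"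

end

definition minimal_decomposition :: "('g \<Rightarrow> 'g \<Rightarrow> 'k) \<Rightarrow> bool"
  where "minimal_decomposition \<beta> \<longleftrightarrow> \<not> (\<exists>g h. g \<noteq> h \<and> (\<forall>x. \<beta> g x = \<beta> h x))"

end

theory Submission
  imports Defs
begin

text \<open>
  Minimality leaves only one commutation factor: \<open>\<beta> 1 1 = - 1\<close>, all other values being \<open>1\<close>. So the
  even component \<open>A0\<close> is central, odd elements anticommute, and by regularity there are nonzero products
  of arbitrarily many odd elements; the algebra behaves like the infinite-dimensional Grassmann algebra
  (lemma \<open>minimal_regular_supercommutative\<close>).

  Write each variable as the sum of an even and an odd letter, and split \<open>f = f0 + f1\<close> and \<open>g = g0 + g1\<close>
  accordingly into even and odd parts (lemma \<open>parity_parts_exist\<close>). Even values are central, and an odd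
  value is central only if it annihilates all odd elements. Hence if \<open>f * g\<close> is central, then
  \<open>(f0 * g1 + f1 * g0) * \<theta> = 0\<close> for all odd \<open>\<theta>\<close>. Suppose that \<open>f\<close> is not central, so that \<open>f1\<close> has a nonzero
  value. Two facts finish the proof.

    \<^item> For odd \<open>\<eta>\<close> the map \<open>x + y \<mapsto> x + y + \<eta> * y\<close>, with \<open>x\<close> even and \<open>y\<close> odd, is multiplicative. Applied
      to the variables of \<open>f\<close> alone, it replaces \<open>f0\<close> by \<open>f0 + \<eta> * f1\<close> and fixes \<open>f1\<close>, \<open>g0\<close>, \<open>g1\<close>, which
      turns the equation above into \<open>\<eta> * f1 * g1 * \<theta> = 0\<close>.

    \<^item> Graded primeness (lemma \<open>graded_prime\<close>): if two polynomials in disjoint sets of letters both have a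
      nonzero graded value, then so does their product, even after multiplication by further odd elements.
      Namely, up to signs a polynomial in the letters is a combination of monomials in commuting even and
      anticommuting odd letters; the monomials are separated by rescaling the letters, and a single
      monomial without a repeated odd letter is nonzero when its even letters are sums of products of pairs
      of odd elements, because then \<open>u ^ k\<close> is \<open>k!\<close> times a product of odd elements.

  The two facts force first \<open>g1 = 0\<close>, then \<open>f1 * g0 * \<theta> = 0\<close> and \<open>g0 = 0\<close>. So \<open>g\<close> is an identity, which
  contradicts that \<open>f * g\<close> is not one (lemmas \<open>odd_part_forces_vanishing\<close> and \<open>central_primeness\<close>). The argument for \<open>g\<close> is
  symmetric because even elements are central.
\<close>

section \<open>Evaluation of noncommutative polynomials\<close>

lemma variables_add: "variables (f + g) \<subseteq> variables f \<union> variables g"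
  using Poly_Mapping.keys_add[of f g] by (auto simp: variables_def)

lemma variables_mult:
  fixes f g :: "'k::semiring_1 free_algebra"
  shows "variables (f * g) \<subseteq> variables f \<union> variables g"
  using keys_mult[of f g] by (fastforce simp: variables_def plus_monomial_def)

lemma variables_single: "variables (Poly_Mapping.single w c) \<subseteq> set (letters w)"
  by (auto simp: variables_def)

lemma free_algebra_induct [case_names zero add]:
  fixes f :: "'k::comm_monoid_add free_algebra"
  assumes "P 0"
    and "\<And>w c f. w \<notin> Poly_Mapping.keys f \<Longrightarrow> c \<noteq> 0 \<Longrightarrow> P f \<Longrightarrow> P (Poly_Mapping.single w c + f)"
  shows "P f"
proof (induction f rule: update_induct)
  case const
  then show ?case using assms(1) by simp
next
  case (update f w c)
  have "Poly_Mapping.update w c f = Poly_Mapping.single w c + f"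
    using update(1) by (intro poly_mapping_eqI)
      (auto simp: lookup_update lookup_add lookup_single not_in_keys_iff_lookup_eq_zero when_def)
  then show ?case using assms(2) update by simp
qed

context algebra_over_field
begin

abbreviation word :: "(nat \<Rightarrow> 'a) \<Rightarrow> nat list \<Rightarrow> 'a"
  where "word b ns \<equiv> prod_list (map b ns)"

lemma eval_superset:
  assumes "finite S" "Poly_Mapping.keys f \<subseteq> S"
  shows "eval b f = (\<Sum>w\<in>S. scale (Poly_Mapping.lookup f w) (word b (letters w)))"
  unfolding eval_def using assms
  by (intro sum.mono_neutral_left) (auto simp: in_keys_iff)

lemma eval_zero [simp]: "eval b 0 = 0"
  by (simp add: eval_def)

lemma eval_single [simp]: "eval b (Poly_Mapping.single w c) = scale c (word b (letters w))"
  by (subst eval_superset[where S = "{w}"]) auto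

lemma eval_add [simp]: "eval b (f + g) = eval b f + eval b g"
proof -
  let ?S = "Poly_Mapping.keys f \<union> Poly_Mapping.keys g"
  have "eval b (f + g) = (\<Sum>w\<in>?S. scale (Poly_Mapping.lookup (f + g) w) (word b (letters w)))"
    using Poly_Mapping.keys_add[of f g] by (intro eval_superset) auto
  also have "\<dots> = (\<Sum>w\<in>?S. scale (Poly_Mapping.lookup f w) (word b (letters w)))
      + (\<Sum>w\<in>?S. scale (Poly_Mapping.lookup g w) (word b (letters w)))"
    by (simp add: lookup_add scale_left_distrib sum.distrib)
  finally show ?thesis
    by (simp add: eval_superset[of ?S f] eval_superset[of ?S g])
qed

lemma eval_mult [simp]: "eval b (f * g) = eval b f * eval b g"
proof (induction f rule: free_algebra_induct)
  case (add u c f)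
  have "eval b (Poly_Mapping.single u c * g) = scale c (word b (letters u)) * eval b g"
  proof (induction g rule: free_algebra_induct)
    case (add v d g)
    then show ?case
      by (simp add: distrib_left mult_single plus_monomial_def scale_mult_left scale_mult_right
          mult.commute)
  qed simp
  with add show ?case
    by (simp add: distrib_right)
qed simp

lemma eval_cong:
  assumes "\<And>n. n \<in> variables f \<Longrightarrow> a n = b n"
  shows "eval a f = eval b f"
proof -
  have "word a (letters w) = word b (letters w)" if "w \<in> Poly_Mapping.keys f" for w
    using that assms by (intro arg_cong[where f = prod_list] map_cong) (auto simp: variables_def)
  then show ?thesis
    unfolding eval_def by (intro sum.cong) auto
qed

lemma word_scale:
  "word (\<lambda>n. scale (s n) (b n)) ns = scale (\<Prod>n\<in>#mset ns. s n) (word b ns)"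
  by (induction ns) (simp_all add: scale_mult_left scale_mult_right mult.commute)

end

section \<open>Linear independence of monomials as characters\<close>

text \<open>
  Distinct exponents give distinct functions because the powers of \<open>2\<close> are distinct in
  characteristic \<open>0\<close>.
\<close>

lemma monomial_separation:
  fixes M N :: "nat multiset"
  assumes "M \<noteq> N"
  shows "\<exists>s. (\<Prod>n\<in>#M. s n) \<noteq> (\<Prod>n\<in>#N. s n :: 'k::field_char_0)"
proof -
  obtain n where n: "count M n \<noteq> count N n"
    using assms by (auto simp: multiset_eq_iff)
  let ?s = "\<lambda>m. if m = n then 2 else 1 :: 'k"
  have s: "(\<Prod>m\<in>#L. ?s m) = of_nat (2 ^ count L n)" for L
    by (induction L) auto
  have "(\<Prod>m\<in>#M. ?s m) \<noteq> (\<Prod>m\<in>#N. ?s m)"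
    unfolding s of_nat_eq_iff using n by simp
  then show ?thesis by blast
qed

text \<open>
  Dedekind's argument for the independence of characters, with coefficients in a vector space: the
  substitution \<open>s \<mapsto> t s\<close> multiplies each term by its own character value at \<open>t\<close>, so one term can be
  cancelled at the cost of multiplying each other term by a difference of two character values, which for
  any given term is nonzero for some \<open>t\<close>. The lemma separates the multihomogeneous components of a
  polynomial function.
\<close>

lemma monomials_independent:
  fixes scale :: "'k::field_char_0 \<Rightarrow> 'v::ab_group_add \<Rightarrow> 'v"
    and \<mu> :: "'i \<Rightarrow> nat multiset"
  assumes "vector_space scale"
    and "finite I" "inj_on \<mu> I"
    and "\<And>s. (\<Sum>i\<in>I. scale (\<Prod>n\<in>#\<mu> i. s n) (z i)) = 0"
    and "i \<in> I"
  shows "z i = 0"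
proof -
  interpret vector_space scale by fact
  have shift: "scale x (scale (y - c) v) = scale (y * x) v - scale c (scale x v)" for x y c v
    by (metis left_diff_distrib mult.commute scale_left_diff_distrib scale_scale)
  show ?thesis
    using assms(2-5)
  proof (induction I arbitrary: z i rule: finite_induct)
    case (insert j J)
    let ?\<chi> = "\<lambda>i s. \<Prod>n\<in>#\<mu> i. s n"
    have sum0: "scale (?\<chi> j s) (z j) + (\<Sum>i\<in>J. scale (?\<chi> i s) (z i)) = 0" for s
      using insert.prems(2)[of s] insert.hyps by simp
    have J0: "z i = 0" if "i \<in> J" for i
    proof -
      have "\<mu> i \<noteq> \<mu> j"
        using insert.prems(1) insert.hyps that by (auto simp: inj_on_def)
      then obtain t :: "nat \<Rightarrow> 'k" where t: "?\<chi> i t \<noteq> ?\<chi> j t"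
        using monomial_separation by blast
      have "scale (?\<chi> i t - ?\<chi> j t) (z i) = 0"
      proof (rule insert.IH[where z = "\<lambda>i. scale (?\<chi> i t - ?\<chi> j t) (z i)"])
        show "inj_on \<mu> J" using insert.prems(1) by (auto simp: inj_on_def)
        show "i \<in> J" by fact
        fix s
        have "(\<Sum>i\<in>J. scale (?\<chi> i s) (scale (?\<chi> i t - ?\<chi> j t) (z i)))
            = (\<Sum>i\<in>J. scale (?\<chi> i (\<lambda>n. t n * s n)) (z i))
              - scale (?\<chi> j t) (\<Sum>i\<in>J. scale (?\<chi> i s) (z i))"
          unfolding scale_sum_right sum_subtractf[symmetric]
          by (intro sum.cong refl) (simp only: prod_mset.distrib shift)
        also have "\<dots> = - scale (?\<chi> j (\<lambda>n. t n * s n)) (z j) - scale (?\<chi> j t) (- scale (?\<chi> j s) (z j))"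
          by (simp only: sum0[THEN minus_unique])
        also have "\<dots> = 0"
          by (simp add: prod_mset.distrib)
        finally show "(\<Sum>i\<in>J. scale (?\<chi> i s) (scale (?\<chi> i t - ?\<chi> j t) (z i))) = 0" .
      qed
      with t show ?thesis by simp
    qed
    moreover have "z j = 0"
      using sum0[of "\<lambda>_. 1"] J0 by simp
    ultimately show ?case
      using insert.prems(3) by auto
  qed simp
qed

section \<open>Supercommutative algebras with long odd products\<close>

text \<open>
  The algebra spanned by \<open>A0\<close> and \<open>A1\<close> is supercommutative, and the last assumption supplies the nonzero
  values from which everything else that has to be nonzero is built.
\<close>

locale supercommutative = algebra_over_field scale
  for scale :: "'k::field_char_0 \<Rightarrow> 'a::ring_1 \<Rightarrow> 'a" +
  fixes A0 A1 :: "'a set"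
  assumes subspace_even: "subspace A0" and subspace_odd: "subspace A1"
    and even_even: "\<And>x y. x \<in> A0 \<Longrightarrow> y \<in> A0 \<Longrightarrow> x * y \<in> A0"
    and even_odd: "\<And>x y. x \<in> A0 \<Longrightarrow> y \<in> A1 \<Longrightarrow> x * y \<in> A1"
    and odd_odd: "\<And>x y. x \<in> A1 \<Longrightarrow> y \<in> A1 \<Longrightarrow> x * y \<in> A0"
    and even_commute: "\<And>x y. x \<in> A0 \<Longrightarrow> y \<in> A0 \<union> A1 \<Longrightarrow> x * y = y * x"
    and odd_anticommute: "\<And>x y. x \<in> A1 \<Longrightarrow> y \<in> A1 \<Longrightarrow> x * y = - (y * x)"
    and nonzero_odd_product: "\<And>n. \<exists>ts. set ts \<subseteq> A1 \<and> length ts = n \<and> prod_list ts \<noteq> 0"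
begin

lemma scale_neg_one: "scale (- 1) x = - x"
  by (simp add: scale_minus_left)

lemma double_eq_zero: "x + x = 0 \<Longrightarrow> x = (0::'a)"
proof -
  assume "x + x = 0"
  moreover have "scale 2 x = x + x"
    using scale_left_distrib[of 1 1 x] by simp
  ultimately show ?thesis by simp
qed

lemma odd_square: "x \<in> A1 \<Longrightarrow> x * x = 0"
  by (rule double_eq_zero, subst eq_neg_iff_add_eq_0[symmetric]) (rule odd_anticommute)

text \<open>
  A variable \<open>x\<^sub>i\<close> is replaced by a pair of letters, the even letter \<open>2 i\<close> and the odd letter
  \<open>2 i + 1\<close>; the parity of a letter is the parity of the values assigned to it.
\<close>

definition graded :: "(nat \<Rightarrow> 'a) \<Rightarrow> bool"
  where "graded b \<longleftrightarrow> (\<forall>n. b n \<in> (if even n then A0 else A1))"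

lemma graded_even: "graded b \<Longrightarrow> even n \<Longrightarrow> b n \<in> A0"
  and graded_odd: "graded b \<Longrightarrow> odd n \<Longrightarrow> b n \<in> A1"
  by (auto simp: graded_def split: if_splits)

lemma graded_scale: "graded b \<Longrightarrow> graded (\<lambda>n. scale (s n) (b n))"
  by (auto simp: graded_def subspace_scale subspace_even subspace_odd)

lemma graded_zero: "graded (\<lambda>n. 0)"
  by (auto simp: graded_def subspace_0 subspace_even subspace_odd)

lemma graded_commute:
  assumes "graded b"
  shows "b m * b n = scale (if odd m \<and> odd n then -1 else 1) (b n * b m)"
proof -
  have mem: "b m \<in> (if even m then A0 else A1)" "b n \<in> (if even n then A0 else A1)"
    using assms by (simp_all add: graded_def)
  show ?thesis
  proof (cases "even m")
    case True
    then show ?thesis using mem even_commute[of "b m" "b n"] by (simp split: if_splits)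
  next
    case False
    then show ?thesis
      using mem even_commute[of "b n" "b m"] odd_anticommute[of "b m" "b n"]
      by (simp add: scale_neg_one split: if_splits)
  qed
qed

text \<open>
  The sign depends only on the letters that are passed, not on the values assigned to them. This
  uniformity in the assignment is what lets terms with equal letters be merged below.
\<close>

lemma word_move_to_front:
  "\<exists>\<epsilon>\<noteq>0. \<forall>b. graded b \<longrightarrow> word b (us @ x # vs) = scale \<epsilon> (word b (x # us @ vs))"
proof (induction us)
  case Nil
  show ?case by (rule exI[of _ 1]) simp
next
  case (Cons u us)
  then obtain \<epsilon> where \<epsilon>: "\<epsilon> \<noteq> 0"
    "\<And>b. graded b \<Longrightarrow> word b (us @ x # vs) = scale \<epsilon> (word b (x # us @ vs))"
    by blast
  let ?\<delta> = "if odd u \<and> odd x then -1 else 1 :: 'k"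
  have "word b ((u # us) @ x # vs) = scale (\<epsilon> * ?\<delta>) (word b (x # (u # us) @ vs))"
    if b: "graded b" for b
  proof -
    have "word b ((u # us) @ x # vs) = scale \<epsilon> ((b u * b x) * word b (us @ vs))"
      using \<epsilon>(2)[OF b] by (simp add: scale_mult_right mult.assoc)
    also have "\<dots> = scale (\<epsilon> * ?\<delta>) ((b x * b u) * word b (us @ vs))"
      by (subst graded_commute[OF b]) (simp only: scale_mult_left scale_scale)
    finally show ?thesis by (simp add: mult.assoc)
  qed
  moreover have "\<epsilon> * ?\<delta> \<noteq> 0" using \<epsilon>(1) by simp
  ultimately show ?case by blast
qed

lemma word_permute:
  assumes "mset ns = mset ms"
  shows "\<exists>\<epsilon>\<noteq>0. \<forall>b. graded b \<longrightarrow> word b ns = scale \<epsilon> (word b ms)"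
  using assms
proof (induction ns arbitrary: ms)
  case Nil
  then show ?case by (intro exI[of _ 1]) simp
next
  case (Cons n ns)
  then have "n \<in> set ms" by (metis list.set_intros(1) set_mset_mset)
  then obtain us vs where ms: "ms = us @ n # vs" by (meson split_list)
  with Cons.prems have "mset ns = mset (us @ vs)" by simp
  then obtain \<delta> where \<delta>: "\<delta> \<noteq> 0" "\<And>b. graded b \<Longrightarrow> word b ns = scale \<delta> (word b (us @ vs))"
    using Cons.IH by blast
  obtain \<epsilon> where \<epsilon>: "\<epsilon> \<noteq> 0" "\<And>b. graded b \<Longrightarrow> word b ms = scale \<epsilon> (word b (n # us @ vs))"
    using word_move_to_front[of us n vs] ms by blast
  have "word b (n # ns) = scale (\<delta> / \<epsilon>) (word b ms)" if b: "graded b" for b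
  proof -
    have "word b (n # ns) = scale \<delta> (word b (n # us @ vs))"
      by (simp add: \<delta>(2)[OF b] scale_mult_right)
    moreover have "word b (n # us @ vs) = scale (1 / \<epsilon>) (word b ms)"
      by (simp only: \<epsilon>(2)[OF b] scale_scale) (simp add: \<epsilon>(1))
    ultimately show ?thesis by (simp only: scale_scale) simp
  qed
  moreover have "\<delta> / \<epsilon> \<noteq> 0" using \<delta> \<epsilon> by simp
  ultimately show ?case by blast
qed

abbreviation sorted_word :: "(nat \<Rightarrow> 'a) \<Rightarrow> nat multiset \<Rightarrow> 'a"
  where "sorted_word b M \<equiv> word b (sorted_list_of_multiset M)"

text \<open>
  The sum can run over multisets of letters because words with the same letters agree up to a sign that
  does not depend on the values. Rescaling the letters multiplies terms with different multisets
  by different functions of the scalars, so that the terms can be told apart.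
\<close>

lemma eval_normal_form:
  obtains I c where "finite I" and "\<And>M. M \<in> I \<Longrightarrow> set_mset M \<subseteq> variables h"
    and "\<And>b. graded b \<Longrightarrow> eval b h = (\<Sum>M\<in>I. scale (c M) (sorted_word b M))"
proof -
  let ?K = "Poly_Mapping.keys h"
  let ?\<mu> = "\<lambda>w. mset (letters w)"
  define \<epsilon> where "\<epsilon> w = (SOME \<epsilon>. \<forall>b. graded b \<longrightarrow> word b (letters w) = scale \<epsilon> (sorted_word b (?\<mu> w)))" for w
  have \<epsilon>: "word b (letters w) = scale (\<epsilon> w) (sorted_word b (?\<mu> w))" if "graded b" for w b
  proof -
    have "\<exists>\<epsilon>. \<forall>b. graded b \<longrightarrow> word b (letters w) = scale \<epsilon> (sorted_word b (?\<mu> w))"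
      using word_permute[of "letters w" "sorted_list_of_multiset (?\<mu> w)"] by auto
    from someI_ex[OF this] show ?thesis
      using that unfolding \<epsilon>_def by blast
  qed
  define c where "c M = (\<Sum>w | w \<in> ?K \<and> ?\<mu> w = M. Poly_Mapping.lookup h w * \<epsilon> w)" for M
  have "eval b h = (\<Sum>M\<in>?\<mu> ` ?K. scale (c M) (sorted_word b M))" if b: "graded b" for b
  proof -
    have "eval b h = (\<Sum>w\<in>?K. scale (Poly_Mapping.lookup h w * \<epsilon> w) (sorted_word b (?\<mu> w)))"
      unfolding eval_def by (intro sum.cong) (simp_all add: \<epsilon>[OF b])
    also have "\<dots> = (\<Sum>M\<in>?\<mu> ` ?K. \<Sum>w | w \<in> ?K \<and> ?\<mu> w = M.
        scale (Poly_Mapping.lookup h w * \<epsilon> w) (sorted_word b (?\<mu> w)))"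
      by (rule sum.image_gen) simp
    also have "\<dots> = (\<Sum>M\<in>?\<mu> ` ?K. scale (c M) (sorted_word b M))"
      unfolding c_def scale_sum_left by (intro sum.cong refl) auto
    finally show ?thesis .
  qed
  moreover have "set_mset M \<subseteq> variables h" if "M \<in> ?\<mu> ` ?K" for M
    using that by (auto simp: variables_def)
  ultimately show thesis
    by (intro that[of "?\<mu> ` ?K" c]) simp_all
qed

lemma odd_letter_once:
  assumes "graded b" "sorted_word b M \<noteq> 0" "odd n"
  shows "count M n \<le> 1"
proof (rule ccontr)
  assume "\<not> count M n \<le> 1"
  then have "replicate_mset 2 n \<subseteq># M"
    by (simp add: count_le_replicate_mset_subset_eq[symmetric])
  then obtain N where "M = replicate_mset 2 n + N"
    by (metis subset_mset.add_diff_inverse)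
  then have "mset (sorted_list_of_multiset M) = mset (n # n # sorted_list_of_multiset N)"
    by (simp add: numeral_2_eq_2)
  then obtain \<epsilon> where "\<And>b. graded b \<Longrightarrow>
      sorted_word b M = scale \<epsilon> (word b (n # n # sorted_list_of_multiset N))"
    using word_permute by blast
  moreover have "b n * (b n * x) = 0" for x
    using odd_square[OF graded_odd[OF assms(1,3)]] by (simp add: mult.assoc[symmetric])
  ultimately show False using assms by simp
qed

section \<open>Nonzero values of words\<close>

text \<open>
  The binomial theorem stops after the linear term when \<open>e * e = 0\<close>.
\<close>

lemma power_add_square_zero:
  fixes u e :: 'a
  assumes "u * e = e * u" "e * e = 0"
  shows "(u + e) ^ Suc m = u ^ Suc m + of_nat (Suc m) * (e * u ^ m)"
proof (induction m)
  case (Suc m)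
  have left: "x * (of_nat n * y) = of_nat n * (x * y)" for x y :: 'a and n
    using mult_of_nat_commute[of n x] by (simp only: mult.assoc[symmetric])
  have ue: "u * (e * x) = e * (u * x)" for x
    using assms(1) by (simp only: mult.assoc[symmetric])
  have ee: "e * (e * x) = 0" for x
    using assms(2) by (simp only: mult.assoc[symmetric] mult_zero_left)
  have "(u + e) ^ Suc (Suc m) = (u + e) * (u ^ Suc m + of_nat (Suc m) * (e * u ^ m))"
    by (subst power_Suc) (simp only: Suc)
  also have "\<dots> = u ^ Suc (Suc m) + (of_nat (Suc m) * (e * u ^ Suc m) + e * u ^ Suc m)"
    by (simp only: distrib_left distrib_right left ue ee power_Suc mult_zero_right add_0_left add_0_right add_ac)
  also have "of_nat (Suc m) * (e * u ^ Suc m) + e * u ^ Suc m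
      = of_nat (Suc (Suc m)) * (e * u ^ Suc m)"
    by (simp only: of_nat_Suc[of "Suc m"] distrib_right mult_1 add.commute)
  finally show ?case .
qed simp

lemma scale_of_nat: "scale (of_nat n) x = of_nat n * x"
  by (induction n) (simp_all only: of_nat_Suc of_nat_0 scale_left_distrib distrib_right
      scale_one scale_zero_left mult_1 mult_zero_left)

text \<open>
  A power of an even letter need not be nonzero merely because the letter is: even elements may be
  nilpotent. Take \<open>u\<close> to be the sum of \<open>k\<close> products of two odd elements each. These summands commute and
  have square zero, so \<open>u ^ k\<close> is \<open>k!\<close> times their product and the next power vanishes, which is what
  the induction needs.
\<close>

lemma even_power_witness:
  assumes "length ts = 2 * k" "set ts \<subseteq> A1"
  shows "\<exists>u\<in>A0. u ^ k = scale (fact k) (prod_list ts) \<and> u ^ Suc k = 0"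
  using assms
proof (induction k arbitrary: ts)
  case 0
  then show ?case by (intro bexI[of _ 0]) (auto simp: subspace_0 subspace_even)
next
  case (Suc k)
  then obtain x y ts' where ts: "ts = x # y # ts'" "length ts' = 2 * k"
    by (auto simp: length_Suc_conv)
  then obtain u where u: "u \<in> A0" "u ^ k = scale (fact k) (prod_list ts')" "u ^ Suc k = 0"
    using Suc by (metis insert_subset list.simps(15))
  have xy: "x \<in> A1" "y \<in> A1" using Suc.prems ts by auto
  let ?e = "x * y"
  have e: "?e \<in> A0" using xy by (rule odd_odd)
  have comm: "u * ?e = ?e * u" using even_commute u(1) e by blast
  have "?e * ?e = x * (y * x) * y" by (simp add: mult.assoc)
  also have "\<dots> = - (x * x) * (y * y)" using odd_anticommute[of y x] xy by (simp add: mult.assoc)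
  finally have sq: "?e * ?e = 0" using odd_square xy by simp
  have "(u + ?e) ^ Suc k = of_nat (Suc k) * (?e * scale (fact k) (prod_list ts'))"
    by (simp only: power_add_square_zero[OF comm sq] u add_0_left)
  also have "\<dots> = scale (fact (Suc k)) (prod_list ts)"
    by (simp only: scale_of_nat[symmetric] scale_mult_right scale_scale ts fact_Suc)
      (simp add: mult.assoc)
  finally have 1: "(u + ?e) ^ Suc k = scale (fact (Suc k)) (prod_list ts)" .
  have "(u + ?e) ^ Suc (Suc k) = 0"
    by (simp only: power_add_square_zero[OF comm sq] power_Suc[of u "Suc k"] u
        mult_zero_right add_0_right)
  with 1 show ?case
    using u(1) e subspace_even by (intro bexI[of _ "u + ?e"]) (auto intro: subspace_add)
qed

text \<open>
  The letters can be given values so that the word becomes a nonzero multiple of a prescribed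
  product of odd elements: each even letter of multiplicity \<open>k\<close> consumes \<open>2 k\<close> of them, each odd letter
  consumes one. An odd letter that occurs twice would square to zero.
\<close>

lemma word_witness:
  assumes "\<And>n. odd n \<Longrightarrow> count (mset ns) n \<le> 1"
  shows "\<exists>N. \<forall>ts. length ts = N \<and> set ts \<subseteq> A1 \<longrightarrow>
    (\<exists>b C. graded b \<and> C \<noteq> 0 \<and> word b ns = scale C (prod_list ts))"
  using assms
proof (induction "length ns" arbitrary: ns rule: less_induct)
  case less
  show ?case
  proof (cases ns)
    case Nil
    show ?thesis
      by (rule exI[of _ 0]) (auto simp: Nil intro!: exI[of _ "\<lambda>n. 0"] exI[of _ 1] graded_zero)
  next
    case (Cons x xs)
    define k where "k = count (mset ns) x"
    define ms where "ms = filter (\<lambda>n. n \<noteq> x) ns"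
    have "length ms < length ns"
      unfolding ms_def by (rule length_filter_less[of x]) (auto simp: Cons)
    moreover have "count (mset ms) n \<le> 1" if "odd n" for n
      using less.prems[OF that] by (simp add: ms_def mset_filter)
    ultimately obtain N where N: "\<And>ts. length ts = N \<Longrightarrow> set ts \<subseteq> A1 \<Longrightarrow>
        \<exists>b C. graded b \<and> C \<noteq> 0 \<and> word b ms = scale C (prod_list ts)"
      using less.hyps by blast
    have "mset ns = mset (replicate k x @ ms)"
      by (auto simp: multiset_eq_iff k_def ms_def)
    then obtain \<epsilon> where \<epsilon>: "\<epsilon> \<noteq> 0"
      "\<And>b. graded b \<Longrightarrow> word b ns = scale \<epsilon> (word b (replicate k x @ ms))"
      using word_permute by blast
    let ?L = "if even x then 2 * k else 1"
    have k1: "k = 1" if "odd x"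
      using less.prems[OF that] by (auto simp: k_def Cons)
    have "\<exists>b C. graded b \<and> C \<noteq> 0 \<and> word b ns = scale C (prod_list ts)"
      if ts: "length ts = ?L + N" "set ts \<subseteq> A1" for ts
    proof -
      define ss where "ss = take ?L ts"
      define rs where "rs = drop ?L ts"
      have split: "ts = ss @ rs" "length ss = ?L" "length rs = N"
        using ts by (simp_all add: ss_def rs_def)
      then have sub: "set ss \<subseteq> A1" "set rs \<subseteq> A1" using ts by auto
      obtain b C where b: "graded b" "C \<noteq> 0" "word b ms = scale C (prod_list rs)"
        using N[OF split(3) sub(2)] by blast
      obtain u where u: "u \<in> (if even x then A0 else A1)"
        "u ^ k = scale (if even x then fact k else 1) (prod_list ss)"
      proof (cases "even x")
        case True
        then show ?thesis using even_power_witness[of ss k] split sub that by auto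
      next
        case False
        then obtain t where "ss = [t]" using split(2) by (auto simp: length_Suc_conv)
        then show ?thesis using that[of t] sub False k1 by auto
      qed
      let ?D = "if even x then fact k else 1 :: 'k"
      let ?b = "b(x := u)"
      have g: "graded ?b" using b(1) u(1) by (auto simp: graded_def split: if_splits)
      have "word ?b ms = word b ms"
        by (intro arg_cong[where f = prod_list] map_cong) (auto simp: ms_def)
      then have "word ?b (replicate k x @ ms) = scale (?D * C) (prod_list ts)"
        using u(2) b(3)
        by (simp add: split(1) prod_list_replicate scale_mult_left scale_mult_right)
      then have "word ?b ns = scale (\<epsilon> * (?D * C)) (prod_list ts)"
        using \<epsilon>(2)[OF g] by simp
      moreover have "\<epsilon> * (?D * C) \<noteq> 0" using \<epsilon>(1) b(2) by simp
      ultimately show ?thesis using g by blast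
    qed
    then show ?thesis by blast
  qed
qed

text \<open>
  The spare odd factors \<open>\<eta>\<close> and \<open>\<theta>\<close> are required because being central is tested by multiplication
  with odd elements, and a second odd element arises from a substitution below.
\<close>

lemma graded_witness:
  assumes "\<And>n. odd n \<Longrightarrow> count (mset ns) n \<le> 1"
  shows "\<exists>b \<eta> \<theta>. graded b \<and> \<eta> \<in> A1 \<and> \<theta> \<in> A1 \<and> word b ns * \<eta> * \<theta> \<noteq> 0"
proof -
  obtain N where N: "\<And>ts. length ts = N \<Longrightarrow> set ts \<subseteq> A1 \<Longrightarrow>
      \<exists>b C. graded b \<and> C \<noteq> 0 \<and> word b ns = scale C (prod_list ts)"
    using word_witness[OF assms] by blast
  obtain ts where ts: "set ts \<subseteq> A1" "length ts = N + 2" "prod_list ts \<noteq> 0"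
    using nonzero_odd_product by blast
  have "length (drop N ts) = 2" using ts(2) by simp
  then obtain \<eta> \<theta> where "drop N ts = [\<eta>, \<theta>]"
    by (auto simp: numeral_2_eq_2 length_Suc_conv simp del: length_drop)
  then have split: "ts = take N ts @ [\<eta>, \<theta>]"
    by (metis append_take_drop_id)
  have "set (take N ts) \<subseteq> A1" "length (take N ts) = N"
    using ts set_take_subset[of N ts] by auto
  then obtain b C where b: "graded b" "C \<noteq> 0" "word b ns = scale C (prod_list (take N ts))"
    using N by blast
  have "word b ns * \<eta> * \<theta> = scale C (prod_list (take N ts @ [\<eta>, \<theta>]))"
    by (simp add: b(3) scale_mult_left mult.assoc)
  then have "word b ns * \<eta> * \<theta> \<noteq> 0"
    using b(2) ts(3) split by simp
  moreover have "\<eta> \<in> A1" "\<theta> \<in> A1"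
    using ts(1) by (subst (asm) split, simp)+
  ultimately show ?thesis using b(1) by blast
qed

lemma eval_rescale_normal_form:
  assumes "\<And>b. graded b \<Longrightarrow> eval b h = (\<Sum>M\<in>I. scale (c M) (sorted_word b M))" "graded b"
  shows "eval (\<lambda>n. scale (s n) (b n)) h
    = (\<Sum>M\<in>I. scale (\<Prod>n\<in>#M. s n) (scale (c M) (sorted_word b M)))"
  by (simp only: assms(1)[OF graded_scale[OF assms(2)]] word_scale mset_sorted_list_of_multiset
      scale_left_commute[of _ "\<Prod>n\<in>#_. s n"])

text \<open>
  Graded primeness. Both polynomials are put into normal form, and a term of each that does not
  vanish identically is chosen. Disjointness of the letters has two effects: the product of the two
  chosen words repeats no odd letter, so that it has a nonzero value; and different pairs of terms have
  different letter multisets, so that rescaling the letters separates the terms of the product and no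
  cancellation can hide the chosen one.
\<close>

lemma graded_prime:
  assumes disj: "variables h \<inter> variables k = {}"
    and h: "graded b1" "eval b1 h \<noteq> 0"
    and k: "graded b2" "eval b2 k \<noteq> 0"
  shows "\<exists>b \<eta> \<theta>. graded b \<and> \<eta> \<in> A1 \<and> \<theta> \<in> A1 \<and> eval b h * eval b k * \<eta> * \<theta> \<noteq> 0"
proof -
  obtain I c where I: "finite I" "\<And>M. M \<in> I \<Longrightarrow> set_mset M \<subseteq> variables h"
    "\<And>b. graded b \<Longrightarrow> eval b h = (\<Sum>M\<in>I. scale (c M) (sorted_word b M))"
    using that by (rule eval_normal_form[of h])
  obtain J d where J: "finite J" "\<And>N. N \<in> J \<Longrightarrow> set_mset N \<subseteq> variables k"
    "\<And>b. graded b \<Longrightarrow> eval b k = (\<Sum>N\<in>J. scale (d N) (sorted_word b N))"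
    using that by (rule eval_normal_form[of k])
  obtain M where M: "M \<in> I" "c M \<noteq> 0" "sorted_word b1 M \<noteq> 0"
  proof -
    obtain M where "M \<in> I" "scale (c M) (sorted_word b1 M) \<noteq> 0"
      using h(2) unfolding I(3)[OF h(1)] by (rule sum.not_neutral_contains_not_neutral)
    then show thesis by (intro that[of M]) auto
  qed
  obtain N where N: "N \<in> J" "d N \<noteq> 0" "sorted_word b2 N \<noteq> 0"
  proof -
    obtain N where "N \<in> J" "scale (d N) (sorted_word b2 N) \<noteq> 0"
      using k(2) unfolding J(3)[OF k(1)] by (rule sum.not_neutral_contains_not_neutral)
    then show thesis by (intro that[of N]) auto
  qed
  have once: "count (mset (sorted_list_of_multiset M @ sorted_list_of_multiset N)) n \<le> 1"
    if n: "odd n" for n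
  proof -
    have "n \<notin># M \<or> n \<notin># N" using I(2)[OF M(1)] J(2)[OF N(1)] disj by blast
    then have "count M n = 0 \<or> count N n = 0" by (simp add: not_in_iff)
    then show ?thesis
      using odd_letter_once[OF h(1) M(3) n] odd_letter_once[OF k(1) N(3) n] by auto
  qed
  obtain b \<eta> \<theta> where b: "graded b" "\<eta> \<in> A1" "\<theta> \<in> A1" "sorted_word b M * sorted_word b N * \<eta> * \<theta> \<noteq> 0"
    using graded_witness[OF once] by auto
  define z where "z = (\<lambda>(M, N). scale (c M) (sorted_word b M) * scale (d N) (sorted_word b N) * \<eta> * \<theta>)"
  have inj: "inj_on (\<lambda>(M, N). M + N) (I \<times> J)"
  proof -
    have left: "filter_mset (\<lambda>n. n \<in> variables h) (M + N) = M" if "M \<in> I" "N \<in> J" for M N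
    proof -
      have "filter_mset (\<lambda>n. n \<in> variables h) M = M"
        using I(2)[OF that(1)] by (intro filter_mset_eq_conv[THEN iffD2]) auto
      moreover have "filter_mset (\<lambda>n. n \<in> variables h) N = {#}"
        using J(2)[OF that(2)] disj by (fastforce simp: multiset_eq_iff not_in_iff)
      ultimately show ?thesis by simp
    qed
    show ?thesis
    proof (rule inj_onI, clarify)
      fix M N M' N'
      assume mem: "M \<in> I" "N \<in> J" "M' \<in> I" "N' \<in> J" and eq: "M + N = M' + N'"
      have "M = M'" using left[OF mem(1,2)] left[OF mem(3,4)] eq by simp
      with eq show "M = M' \<and> N = N'" by simp
    qed
  qed
  have "\<exists>s. eval (\<lambda>n. scale (s n) (b n)) h * eval (\<lambda>n. scale (s n) (b n)) k * \<eta> * \<theta> \<noteq> 0"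
  proof (rule ccontr)
    assume "\<not> ?thesis"
    then have zero: "eval (\<lambda>n. scale (s n) (b n)) h * eval (\<lambda>n. scale (s n) (b n)) k * \<eta> * \<theta> = 0" for s
      by blast
    have pull: "scale u x * scale v y * \<eta> * \<theta> = scale (u * v) (x * y * \<eta> * \<theta>)" for u v x y
      by (subst scale_mult_left, subst scale_mult_right) (simp only: scale_mult_left scale_scale)
    have "(\<Sum>p\<in>I \<times> J. scale (\<Prod>n\<in>#(case p of (M, N) \<Rightarrow> M + N). s n) (z p)) = 0" for s
    proof -
      have "0 = (\<Sum>M\<in>I. scale (\<Prod>n\<in>#M. s n) (scale (c M) (sorted_word b M)))
          * (\<Sum>N\<in>J. scale (\<Prod>n\<in>#N. s n) (scale (d N) (sorted_word b N))) * \<eta> * \<theta>"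
        using zero[of s] eval_rescale_normal_form[OF I(3) b(1)]
          eval_rescale_normal_form[OF J(3) b(1)] by simp
      also have "\<dots> = (\<Sum>(M, N)\<in>I \<times> J. scale (\<Prod>n\<in>#M. s n) (scale (c M) (sorted_word b M))
          * scale (\<Prod>n\<in>#N. s n) (scale (d N) (sorted_word b N)) * \<eta> * \<theta>)"
        unfolding sum_product unfolding sum.cartesian_product sum_distrib_right
        by (intro sum.cong refl) auto
      also have "\<dots> = (\<Sum>p\<in>I \<times> J. scale (\<Prod>n\<in>#(case p of (M, N) \<Rightarrow> M + N). s n) (z p))"
        by (intro sum.cong refl) (simp add: z_def pull split: prod.split del: scale_scale)
      finally show ?thesis by simp
    qed
    then have "z (M, N) = 0"
      using monomials_independent[OF vector_space_axioms _ inj, of z "(M, N)"] I(1) J(1) M(1) N(1)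
      by blast
    then show False
      using b(4) M(2) N(2) by (simp add: z_def scale_mult_left scale_mult_right)
  qed
  then show ?thesis
    using graded_scale[OF b(1)] b(2,3) by blast
qed

section \<open>Even and odd parts of a polynomial\<close>

text \<open>
  Because of constant terms, the even part of a polynomial takes its values in \<open>K 1 + A0\<close>, that is, in
  \<open>unital_hull A0\<close>; this set inherits from \<open>A0\<close> that its elements are central.
\<close>

lemma hull_evenE:
  assumes "x \<in> unital_hull A0"
  obtains c a where "a \<in> A0" "x = scale c 1 + a"
  using assms by (auto simp: unital_hull_def)

lemma one_hull: "1 \<in> unital_hull A0"
proof -
  have "(1::'a) = scale 1 1 + 0" by simp
  then show ?thesis unfolding unital_hull_def using subspace_0[OF subspace_even] by blast
qed

lemma zero_hull: "0 \<in> unital_hull A0"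
  unfolding unital_hull_def using subspace_0[OF subspace_even]
  by (auto intro!: exI[of _ 0])

lemma even_hull: "x \<in> A0 \<Longrightarrow> x \<in> unital_hull A0"
  unfolding unital_hull_def by (auto intro!: exI[of _ 0] exI[of _ x])

lemma hull_add:
  assumes "x \<in> unital_hull A0" "y \<in> unital_hull A0"
  shows "x + y \<in> unital_hull A0"
proof -
  obtain c a d e where "a \<in> A0" "x = scale c 1 + a" "e \<in> A0" "y = scale d 1 + e"
    using assms by (meson hull_evenE)
  then have "a + e \<in> A0" "x + y = scale (c + d) 1 + (a + e)"
    by (simp_all add: subspace_add[OF subspace_even] scale_left_distrib add_ac)
  then show ?thesis unfolding unital_hull_def by blast
qed

lemma hull_scale:
  assumes "x \<in> unital_hull A0"
  shows "scale c x \<in> unital_hull A0"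
proof -
  obtain d a where "a \<in> A0" "x = scale d 1 + a"
    using assms by (meson hull_evenE)
  then have "scale c a \<in> A0" "scale c x = scale (c * d) 1 + scale c a"
    by (simp_all add: subspace_scale[OF subspace_even] scale_right_distrib)
  then show ?thesis unfolding unital_hull_def by blast
qed

lemma even_hull_mult:
  assumes "x \<in> A0" "y \<in> unital_hull A0"
  shows "x * y \<in> A0"
proof -
  obtain c a where a: "a \<in> A0" "y = scale c 1 + a"
    using assms by (meson hull_evenE)
  then have "x * y = scale c x + x * a"
    by (simp add: distrib_left scale_mult_right)
  then show ?thesis
    using a assms(1)
    by (simp add: subspace_add[OF subspace_even] subspace_scale[OF subspace_even] even_even)
qed

lemma hull_mult:
  assumes "x \<in> unital_hull A0" "y \<in> unital_hull A0"
  shows "x * y \<in> unital_hull A0"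
proof -
  obtain c a where a: "a \<in> A0" "x = scale c 1 + a"
    using assms by (meson hull_evenE)
  then have "x * y = scale c y + a * y"
    by (simp add: distrib_right scale_mult_left)
  then show ?thesis
    using a assms(2) by (simp add: hull_add hull_scale even_hull even_hull_mult)
qed

lemma odd_hull_mult:
  assumes "x \<in> A1" "y \<in> unital_hull A0"
  shows "x * y \<in> A1" and "y * x \<in> A1" and "x * y = y * x"
proof -
  obtain c a where a: "a \<in> A0" "y = scale c 1 + a"
    using assms by (meson hull_evenE)
  have comm: "a * x = x * a" using even_commute a assms by blast
  then show "x * y = y * x"
    by (simp add: a distrib_left distrib_right scale_mult_left scale_mult_right)
  moreover show "y * x \<in> A1"
    using a assms(1) by (auto simp: distrib_right scale_mult_left
        intro!: subspace_add[OF subspace_odd] subspace_scale[OF subspace_odd] even_odd)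
  ultimately show "x * y \<in> A1" by simp
qed

lemma even_hull_commute:
  assumes "x \<in> A0" "y \<in> unital_hull A0"
  shows "x * y = y * x"
  using assms even_commute
  by (auto elim!: hull_evenE simp: distrib_left distrib_right scale_mult_left scale_mult_right)

definition assembled :: "(nat \<Rightarrow> 'a) \<Rightarrow> nat \<Rightarrow> 'a"
  where "assembled b i = b (2 * i) + b (Suc (2 * i))"

text \<open>
  The effect on letters of the map \<open>x + y \<mapsto> x + y + \<theta> * y\<close> (\<open>x\<close> even, \<open>y\<close> odd), whose additional summand is
  even. By supercommutativity the map is multiplicative, because \<open>\<theta> * y * (\<theta> * y') = 0\<close> and
  \<open>\<theta> * y * y' + y * (\<theta> * y') = 0\<close>.
\<close>

definition twist :: "'a \<Rightarrow> (nat \<Rightarrow> 'a) \<Rightarrow> nat \<Rightarrow> 'a"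
  where "twist \<theta> b n = (if even n then b n + \<theta> * b (Suc n) else b n)"

text \<open>
  The last clause says how the two parts behave under the multiplicative map above; with it,
  information on the even part of a polynomial carries over to the odd part.
  The function \<open>F\<close> stands for evaluation of a polynomial in the variables \<open>V\<close>; a function rather than a
  polynomial lets the parts be built up word by word.
\<close>

definition parity_parts ::
    "nat set \<Rightarrow> ((nat \<Rightarrow> 'a) \<Rightarrow> 'a) \<Rightarrow> 'k free_algebra \<Rightarrow> 'k free_algebra \<Rightarrow> bool"
  where "parity_parts V F h0 h1 \<longleftrightarrow>
    variables h0 \<union> variables h1 \<subseteq> {n. n div 2 \<in> V} \<and>
    (\<forall>b. graded b \<longrightarrow>
      F (assembled b) = eval b h0 + eval b h1 \<and>
      eval b h0 \<in> unital_hull A0 \<and> eval b h1 \<in> A1 \<and>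
      (\<forall>\<theta>\<in>A1. eval (twist \<theta> b) h0 = eval b h0 + \<theta> * eval b h1 \<and>
        eval (twist \<theta> b) h1 = eval b h1))"

text \<open>
  For \<open>F\<close> with parts \<open>h0, h1\<close> and a new variable with even letter \<open>u\<close> and odd letter \<open>v\<close>, the parts of
  \<open>(u + v) * F\<close> are \<open>u * h0 + v * h1\<close> and \<open>u * h1 + v * h0\<close>.
\<close>

lemma parity_parts_word:
  assumes "set ns \<subseteq> V"
  shows "\<exists>h0 h1. parity_parts V (\<lambda>a. word a ns) h0 h1"
  using assms
proof (induction ns)
  case Nil
  have "parity_parts V (\<lambda>a. word a []) (Poly_Mapping.single 0 1) 0"
    by (auto simp: parity_parts_def variables_def zero_monomial_def one_hull
        subspace_0[OF subspace_odd])
  then show ?case by blast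
next
  case (Cons i ns)
  then obtain h0 h1 where h: "parity_parts V (\<lambda>a. word a ns) h0 h1" by auto
  let ?X = "\<lambda>n. Poly_Mapping.single (Monomial [n]) 1 :: 'k free_algebra"
  let ?u = "?X (2 * i)" and ?v = "?X (Suc (2 * i))"
  have "parity_parts V (\<lambda>a. word a (i # ns)) (?u * h0 + ?v * h1) (?u * h1 + ?v * h0)"
    unfolding parity_parts_def
  proof (intro conjI allI impI ballI)
    have "variables h0 \<union> variables h1 \<subseteq> {n. n div 2 \<in> V}"
      using h by (simp add: parity_parts_def)
    moreover have "variables ?u \<union> variables ?v \<subseteq> {n. n div 2 \<in> V}"
      using Cons.prems by (auto simp: variables_def)
    ultimately show "variables (?u * h0 + ?v * h1) \<union> variables (?u * h1 + ?v * h0)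
        \<subseteq> {n. n div 2 \<in> V}"
      using variables_add[of "?u * h0" "?v * h1"] variables_add[of "?u * h1" "?v * h0"]
        variables_mult[of ?u h0] variables_mult[of ?v h1] variables_mult[of ?u h1]
        variables_mult[of ?v h0] by blast
  next
    fix b assume b: "graded b"
    let ?U = "b (2 * i)" and ?V = "b (Suc (2 * i))"
    have U: "?U \<in> A0" and V: "?V \<in> A1"
      using graded_even[OF b] graded_odd[OF b] by simp_all
    have e: "word (assembled b) ns = eval b h0 + eval b h1"
      and h0: "eval b h0 \<in> unital_hull A0" and h1: "eval b h1 \<in> A1"
      using h b by (simp_all add: parity_parts_def)
    show "word (assembled b) (i # ns) = eval b (?u * h0 + ?v * h1) + eval b (?u * h1 + ?v * h0)"
      using e by (simp add: assembled_def distrib_left distrib_right)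
    show "eval b (?u * h0 + ?v * h1) \<in> unital_hull A0"
      using U V h0 h1 by (simp add: even_hull_mult odd_odd even_hull hull_add)
    show "eval b (?u * h1 + ?v * h0) \<in> A1"
      using U V h0 h1 by (simp add: odd_hull_mult even_odd subspace_add[OF subspace_odd])
    fix \<theta> assume \<theta>: "\<theta> \<in> A1"
    have t: "eval (twist \<theta> b) h0 = eval b h0 + \<theta> * eval b h1" "eval (twist \<theta> b) h1 = eval b h1"
      using h b \<theta> by (simp_all add: parity_parts_def)
    have c: "?U * \<theta> = \<theta> * ?U" "?V * \<theta> = - (\<theta> * ?V)"
      using even_commute U \<theta> odd_anticommute[OF V \<theta>] by blast+
    have c': "?U * (\<theta> * x) = \<theta> * (?U * x)" "?V * (\<theta> * x) = - (\<theta> * (?V * x))" for x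
      using c by (simp_all add: mult.assoc[symmetric])
    have sq: "\<theta> * (\<theta> * x) = 0" for x
      using odd_square[OF \<theta>] by (simp add: mult.assoc[symmetric])
    show "eval (twist \<theta> b) (?u * h0 + ?v * h1)
        = eval b (?u * h0 + ?v * h1) + \<theta> * eval b (?u * h1 + ?v * h0)"
      by (simp add: t twist_def distrib_left distrib_right c' sq mult.assoc)
    show "eval (twist \<theta> b) (?u * h1 + ?v * h0) = eval b (?u * h1 + ?v * h0)"
      by (simp add: t twist_def distrib_left distrib_right c' sq mult.assoc)
  qed
  then show ?case by blast
qed

lemma parity_parts_add_scale:
  fixes c :: 'k
  assumes F: "parity_parts V F h0 h1" and G: "parity_parts V G k0 k1"
  defines "C \<equiv> Poly_Mapping.single 0 c"
  shows "parity_parts V (\<lambda>a. scale c (F a) + G a) (C * h0 + k0) (C * h1 + k1)"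
proof -
  have ev: "eval b (C * h + k) = scale c (eval b h) + eval b k" for b h k
    by (simp add: C_def zero_monomial_def scale_mult_left)
  have var: "variables (C * h + k) \<subseteq> variables h \<union> variables k" for h k
    using variables_add[of "C * h" k] variables_mult[of C h]
      variables_single[of 0 c] by (auto simp: C_def zero_monomial_def)
  have "variables (C * h0 + k0) \<union> variables (C * h1 + k1) \<subseteq> {n. n div 2 \<in> V}"
    using var[of h0 k0] var[of h1 k1] F G unfolding parity_parts_def by blast
  then show ?thesis
    using F G unfolding parity_parts_def ev
    by (auto simp: hull_add hull_scale subspace_add[OF subspace_odd] subspace_scale[OF subspace_odd]
        scale_right_distrib distrib_left scale_mult_right add_ac)
qed

lemma parity_parts_exist:
  "\<exists>h0 h1. parity_parts (variables f) (\<lambda>a. eval a f) h0 h1"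
proof -
  have "\<exists>h0 h1. parity_parts V (\<lambda>a. \<Sum>w\<in>S. scale (c w) (word a (letters w))) h0 h1"
    if "finite S" "\<And>w. w \<in> S \<Longrightarrow> set (letters w) \<subseteq> V" for S V c
    using that
  proof (induction S rule: finite_induct)
    case empty
    have "parity_parts V (\<lambda>a. 0) 0 0"
      by (auto simp: parity_parts_def variables_def zero_hull subspace_0[OF subspace_odd])
    then show ?case by auto
  next
    case (insert w S)
    then obtain h0 h1 k0 k1 where "parity_parts V (\<lambda>a. word a (letters w)) h0 h1"
      "parity_parts V (\<lambda>a. \<Sum>w\<in>S. scale (c w) (word a (letters w))) k0 k1"
      using parity_parts_word by (meson insert_iff)
    from parity_parts_add_scale[OF this, of "c w"] show ?case
      using insert.hyps by auto
  qed
  from this[of "Poly_Mapping.keys f" "variables f" "Poly_Mapping.lookup f"] show ?thesis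
    unfolding eval_def by (auto simp: variables_def)
qed

section \<open>Primeness for central polynomials\<close>

text \<open>
  The hypothesis \<open>kill\<close> is centrality of a product: its odd part annihilates all odd elements. Twisting
  only the variables of the first factor adds \<open>\<eta> * h1\<close> to its even part and leaves everything
  else alone, so the difference of the two instances of the hypothesis is \<open>\<eta> * h1 * k1 * \<theta> = 0\<close>. Graded
  primeness removes \<open>k1\<close>, then the hypothesis reduces to \<open>h1 * k0 * \<theta> = 0\<close>, and graded primeness removes
  \<open>k0\<close>.
\<close>

lemma odd_part_forces_vanishing:
  assumes F: "parity_parts V F h0 h1" and G: "parity_parts W G k0 k1" and "V \<inter> W = {}"
    and kill: "\<And>b \<theta>. graded b \<Longrightarrow> \<theta> \<in> A1 \<Longrightarrow>
      (eval b h0 * eval b k1 + eval b h1 * eval b k0) * \<theta> = 0"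
    and b1: "graded b1" "eval b1 h1 \<noteq> 0"
    and b2: "graded b2"
  shows "eval b2 k0 = 0" and "eval b2 k1 = 0"
proof -
  have vars: "variables h0 \<union> variables h1 \<subseteq> {n. n div 2 \<in> V}"
    "variables k0 \<union> variables k1 \<subseteq> {n. n div 2 \<in> W}"
    using F G by (simp_all add: parity_parts_def)
  then have disj: "variables h1 \<inter> variables k0 = {}" "variables h1 \<inter> variables k1 = {}"
    using assms(3) by auto
  have odd_odd_zero: "eval b h1 * eval b k1 * \<eta> * \<theta> = 0"
    if b: "graded b" and \<eta>: "\<eta> \<in> A1" and \<theta>: "\<theta> \<in> A1" for b \<eta> \<theta>
  proof -
    define b' where "b' n = (if n div 2 \<in> V then twist \<eta> b n else b n)" for n
    have "\<eta> * b (Suc n) \<in> A0" if "even n" for n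
      using \<eta> graded_odd[OF b, of "Suc n"] that odd_odd by simp
    then have gr: "graded b'"
      using graded_even[OF b] graded_odd[OF b]
      by (auto simp: graded_def b'_def twist_def subspace_add[OF subspace_even])
    have "eval b' h0 = eval (twist \<eta> b) h0" "eval b' h1 = eval (twist \<eta> b) h1"
      using vars(1) by (auto intro!: eval_cong simp: b'_def)
    then have h: "eval b' h0 = eval b h0 + \<eta> * eval b h1" "eval b' h1 = eval b h1"
      using F b \<eta> by (simp_all add: parity_parts_def)
    have k: "eval b' k0 = eval b k0" "eval b' k1 = eval b k1"
    proof -
      have "b' n = b n" if "n \<in> variables k0 \<union> variables k1" for n
        using vars(2) assms(3) that unfolding b'_def by auto
      then show "eval b' k0 = eval b k0" "eval b' k1 = eval b k1"
        by (blast intro: eval_cong)+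
    qed
    have "\<eta> * (eval b h1 * eval b k1) * \<theta> = 0"
    proof -
      have "(eval b h0 + \<eta> * eval b h1) * eval b k1 + eval b h1 * eval b k0
          = \<eta> * (eval b h1 * eval b k1) + (eval b h0 * eval b k1 + eval b h1 * eval b k0)"
        by (simp only: distrib_right mult.assoc add_ac)
      then have "(\<eta> * (eval b h1 * eval b k1)
          + (eval b h0 * eval b k1 + eval b h1 * eval b k0)) * \<theta> = 0"
        using kill[OF gr \<theta>] unfolding h k by (simp only:)
      then show ?thesis
        using kill[OF b \<theta>] by (simp only: distrib_right[of "\<eta> * _"] add_0_right)
    qed
    moreover have "eval b h1 * eval b k1 \<in> A0"
      using F G b by (intro odd_odd) (simp_all add: parity_parts_def)
    then have "\<eta> * (eval b h1 * eval b k1) = eval b h1 * eval b k1 * \<eta>"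
      using even_commute[of "eval b h1 * eval b k1" \<eta>] \<eta> by simp
    ultimately show ?thesis by simp
  qed
  have k1: "eval b k1 = 0" if "graded b" for b
    using graded_prime[OF disj(2) b1 that] odd_odd_zero by blast
  then show "eval b2 k1 = 0" using b2 .
  show "eval b2 k0 = 0"
  proof (rule ccontr)
    assume "eval b2 k0 \<noteq> 0"
    then obtain b \<eta> \<theta> where b: "graded b" "\<eta> \<in> A1" "eval b h1 * eval b k0 * \<eta> * \<theta> \<noteq> 0"
      using graded_prime[OF disj(1) b1 b2] by blast
    then show False using kill[OF b(1,2)] k1[OF b(1)] by simp
  qed
qed

text \<open>
  An element is central as soon as its odd part vanishes, and the odd part of a central element
  annihilates all odd elements. If a factor of a proper central polynomial had a nonzero odd part, the other
  factor would therefore vanish identically.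
\<close>

lemma central_primeness:
  assumes sub: "subspace A" "A0 \<subseteq> A" "A1 \<subseteq> A"
    and decomp: "\<And>a. a \<in> A \<Longrightarrow> \<exists>x\<in>A0. \<exists>y\<in>A1. a = x + y"
  shows "central_primeness_property A"
proof -
  have assembledE: "\<exists>b. graded b \<and> a = assembled b" if a: "range a \<subseteq> A" for a :: "nat \<Rightarrow> 'a"
  proof -
    have "a i \<in> A" for i
      using a by (simp add: image_subset_iff)
    then have "\<forall>i. \<exists>p. fst p \<in> A0 \<and> snd p \<in> A1 \<and> a i = fst p + snd p"
      using decomp by fastforce
    from choice[OF this] obtain p
      where p: "\<And>i. fst (p i) \<in> A0 \<and> snd (p i) \<in> A1 \<and> a i = fst (p i) + snd (p i)"
      by blast
    define b where "b n = (if even n then fst (p (n div 2)) else snd (p (n div 2)))" for n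
    have "graded b" "a = assembled b"
      using p by (simp_all add: graded_def b_def assembled_def fun_eq_iff)
    then show ?thesis by blast
  qed
  have assembled_in: "range (assembled b) \<subseteq> A" if "graded b" for b
    using sub graded_even[OF that] graded_odd[OF that]
    by (auto simp: assembled_def intro!: subspace_add)
  have hull: "unital_hull A0 \<subseteq> unital_hull A"
    using sub by (auto simp: unital_hull_def)
  have odd_in: "x \<in> unital_hull A" if "x \<in> A1" for x
    unfolding unital_hull_def using that sub by (auto intro!: exI[of _ 0] exI[of _ x])
  have even_central: "z \<in> centre (unital_hull A)" if z: "z \<in> unital_hull A0" for z
  proof -
    have "z * r = r * z" if r_in: "r \<in> unital_hull A" for r
    proof -
      obtain c a where r: "a \<in> A" "r = scale c 1 + a"
        using r_in by (auto simp: unital_hull_def)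
      obtain x y where xy: "x \<in> A0" "y \<in> A1" "a = x + y"
        using decomp r by blast
      show ?thesis
        using even_hull_commute[OF xy(1) z] odd_hull_mult(3)[OF xy(2) z]
        by (simp add: r xy distrib_left distrib_right scale_mult_left scale_mult_right)
    qed
    then show ?thesis using hull z by (auto simp: centre_def)
  qed
  have central_odd: "z1 * \<theta> = 0"
    if z: "z0 + z1 \<in> centre (unital_hull A)" "z0 \<in> unital_hull A0" "z1 \<in> A1" and \<theta>: "\<theta> \<in> A1"
    for z0 z1 \<theta>
  proof -
    have "(z0 + z1) * \<theta> = \<theta> * (z0 + z1)"
      using z(1) odd_in[OF \<theta>] by (simp add: centre_def)
    then have "z1 * \<theta> = \<theta> * z1"
      using odd_hull_mult(3)[OF \<theta> z(2)] by (simp add: distrib_left distrib_right)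
    then have "z1 * \<theta> + z1 * \<theta> = 0"
      using odd_anticommute[OF \<theta> z(3)] by (simp only: add.right_inverse flip: eq_neg_iff_add_eq_0)
    then show ?thesis by (rule double_eq_zero)
  qed
  have central: "central_polynomial A f"
    if f: "parity_parts V (\<lambda>a. eval a f) h0 h1" "\<And>b. graded b \<Longrightarrow> eval b h1 = 0" for V f h0 h1
    unfolding central_polynomial_def
  proof (intro allI impI)
    fix a :: "nat \<Rightarrow> 'a" assume "range a \<subseteq> A"
    then obtain b where "graded b" "a = assembled b" using assembledE by blast
    then show "eval a f \<in> centre (unital_hull A)"
      using f even_central by (simp add: parity_parts_def)
  qed
  show ?thesis
    unfolding central_primeness_property_def
  proof (intro allI impI, elim conjE)
    fix f g :: "'k free_algebra"
    assume disj: "variables f \<inter> variables g = {}"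
      and proper: "proper_central_polynomial A (f * g)"
    obtain h0 h1 where h: "parity_parts (variables f) (\<lambda>a. eval a f) h0 h1"
      using parity_parts_exist by blast
    obtain k0 k1 where k: "parity_parts (variables g) (\<lambda>a. eval a g) k0 k1"
      using parity_parts_exist by blast
    have hb: "eval (assembled b) f = eval b h0 + eval b h1"
      "eval b h0 \<in> unital_hull A0" "eval b h1 \<in> A1" if "graded b" for b
      using h that by (simp_all add: parity_parts_def)
    have kb: "eval (assembled b) g = eval b k0 + eval b k1"
      "eval b k0 \<in> unital_hull A0" "eval b k1 \<in> A1" if "graded b" for b
      using k that by (simp_all add: parity_parts_def)
    have kill: "(eval b h0 * eval b k1 + eval b h1 * eval b k0) * \<theta> = 0"
      if b: "graded b" and \<theta>: "\<theta> \<in> A1" for b \<theta>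
    proof (rule central_odd[OF _ _ _ \<theta>])
      have "eval (assembled b) (f * g) \<in> centre (unital_hull A)"
        using proper assembled_in[OF b]
        by (simp add: proper_central_polynomial_def central_polynomial_def del: eval_mult)
      then show "(eval b h0 * eval b k0 + eval b h1 * eval b k1)
          + (eval b h0 * eval b k1 + eval b h1 * eval b k0) \<in> centre (unital_hull A)"
        by (simp add: hb[OF b] kb[OF b] distrib_left distrib_right add_ac)
      show "eval b h0 * eval b k0 + eval b h1 * eval b k1 \<in> unital_hull A0"
        using hb[OF b] kb[OF b] by (simp add: hull_add hull_mult even_hull odd_odd)
      show "eval b h0 * eval b k1 + eval b h1 * eval b k0 \<in> A1"
        using hb[OF b] kb[OF b] by (simp add: subspace_add[OF subspace_odd] odd_hull_mult)
    qed
    obtain a where a: "range a \<subseteq> A" "eval a (f * g) \<noteq> 0"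
      using proper unfolding proper_central_polynomial_def polynomial_identity_def by blast
    obtain b0 where "graded b0" "a = assembled b0"
      using assembledE[OF a(1)] by blast
    with a(2) have b0: "graded b0" "eval (assembled b0) f * eval (assembled b0) g \<noteq> 0"
      by simp_all
    have "eval b h1 = 0" if b: "graded b" for b
    proof (rule ccontr)
      assume "eval b h1 \<noteq> 0"
      then have "eval b0 k0 = 0" "eval b0 k1 = 0"
        using odd_part_forces_vanishing[OF h k disj kill b] b0(1) by blast+
      then show False using b0 kb by simp
    qed
    then have 1: "central_polynomial A f" using central[OF h] by blast
    have "eval b k1 = 0" if b: "graded b" for b
    proof (rule ccontr)
      have kill': "(eval b k0 * eval b h1 + eval b k1 * eval b h0) * \<theta> = 0"
        if "graded b" "\<theta> \<in> A1" for b \<theta>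
        using kill[OF that] odd_hull_mult(3)[OF kb(3) hb(2)] odd_hull_mult(3)[OF hb(3) kb(2)] that(1)
        by (simp add: add.commute)
      assume "eval b k1 \<noteq> 0"
      then have "eval b0 h0 = 0" "eval b0 h1 = 0"
        using odd_part_forces_vanishing[OF k h _ kill' b] b0(1) disj by (simp_all add: Int_commute)
      then show False using b0 hb by simp
    qed
    then have "central_polynomial A g" using central[OF k] by blast
    with 1 show "central_polynomial A f \<and> central_polynomial A g" by blast
  qed
qed

end

context algebra_over_field
begin

section \<open>Minimal regular gradings by the group of order two\<close>

lemma regular_product:
  assumes "regular_grading A \<Gamma> \<beta>" "gs \<noteq> []"
  obtains as where "list_all2 (\<lambda>g a. a \<in> \<Gamma> g) gs as" "prod_list as \<noteq> 0"
  using assms unfolding regular_grading_def by blast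

lemma regular_commute:
  assumes "regular_grading A \<Gamma> \<beta>" "a \<in> \<Gamma> g" "b \<in> \<Gamma> h"
  shows "a * b = scale (\<beta> g h) (b * a)"
  using assms unfolding regular_grading_def by blast

text \<open>
  A product of two elements of degree \<open>0\<close> has degree \<open>0\<close> again, so moving it past \<open>c\<close> in one or in two
  steps gives \<open>\<beta> 0 g = (\<beta> 0 g)\<^sup>2\<close>; the comparison is made on a nonzero product.
\<close>

lemma regular_commutation_zero:
  assumes reg: "regular_grading A \<Gamma> \<beta>"
  shows "\<beta> 0 g = 1" and "\<beta> g 0 = 1"
proof -
  obtain as where as: "list_all2 (\<lambda>g a. a \<in> \<Gamma> g) [0, 0, g] as" "prod_list as \<noteq> 0"
    using regular_product[OF reg, of "[0, 0, g]"] by blast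
  then obtain a b c where abc: "a \<in> \<Gamma> 0" "b \<in> \<Gamma> 0" "c \<in> \<Gamma> g" "a * (b * c) \<noteq> 0"
    by (auto simp: list_all2_Cons1)
  have ab: "a * b \<in> \<Gamma> 0"
    using reg abc unfolding regular_grading_def is_grading_def by (metis add_0)
  let ?y = "c * (a * b)"
  have 1: "a * (b * c) = scale (\<beta> 0 g) ?y"
    using regular_commute[OF reg ab abc(3)] by (simp add: mult.assoc)
  have "a * (b * c) = scale (\<beta> 0 g) (a * c * b)"
    by (simp only: regular_commute[OF reg abc(2,3)] scale_mult_right mult.assoc)
  also have "\<dots> = scale (\<beta> 0 g * \<beta> 0 g) ?y"
    by (simp only: regular_commute[OF reg abc(1,3)] scale_mult_left scale_scale mult.assoc)
  finally have "scale (\<beta> 0 g) ?y = scale (\<beta> 0 g * \<beta> 0 g) ?y"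
    using 1 by simp
  moreover have "?y \<noteq> 0" using 1 abc(4) by auto
  ultimately have "\<beta> 0 g = \<beta> 0 g * \<beta> 0 g" by (metis scale_right_imp_eq)
  moreover have "\<beta> 0 g \<noteq> 0" using reg by (simp add: regular_grading_def)
  ultimately show 0: "\<beta> 0 g = 1" by simp
  have "b * c = c * b"
    using regular_commute[OF reg abc(2,3)] by (simp only: 0 scale_one)
  then have "scale (\<beta> g 0) (b * c) = scale 1 (b * c)"
    using regular_commute[OF reg abc(3,2)] by (simp only: scale_one)
  moreover have "b * c \<noteq> 0" using abc(4) by auto
  ultimately show "\<beta> g 0 = 1" by (metis scale_right_imp_eq)
qed

text \<open>
  Exchanging two factors twice restores the product.
\<close>

lemma regular_commutation_square:
  assumes reg: "regular_grading A \<Gamma> \<beta>"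
  shows "\<beta> g g * \<beta> g g = 1"
proof -
  obtain as where "list_all2 (\<lambda>g a. a \<in> \<Gamma> g) [g, g] as" "prod_list as \<noteq> 0"
    using regular_product[OF reg, of "[g, g]"] by blast
  then obtain a b where ab: "a \<in> \<Gamma> g" "b \<in> \<Gamma> g" "a * b \<noteq> 0"
    by (auto simp: list_all2_Cons1)
  have "a * b = scale (\<beta> g g) (scale (\<beta> g g) (a * b))"
    by (simp only: regular_commute[OF reg ab(1,2), symmetric] regular_commute[OF reg ab(2,1), symmetric])
  then have "scale (\<beta> g g * \<beta> g g) (a * b) = scale 1 (a * b)" by simp
  with ab(3) show ?thesis by (metis scale_right_imp_eq)
qed

end

lemma UNIV_two: "(UNIV :: 2 set) = {0, 1}"
  by (rule card_subset_eq[symmetric]) simp_all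

text \<open>
  All values of \<open>\<beta>\<close> except \<open>\<beta> 1 1\<close> equal \<open>1\<close>, and \<open>(\<beta> 1 1)\<^sup>2 = 1\<close>. If \<open>\<beta> 1 1 = 1\<close>, the two degrees would not be
  distinguished by \<open>\<beta>\<close>, against minimality.
\<close>

lemma minimal_regular_supercommutative:
  fixes scale :: "'k::field_char_0 \<Rightarrow> 'a::ring_1 \<Rightarrow> 'a"
    and \<Gamma> :: "2 \<Rightarrow> 'a set"
  assumes "algebra_over_field scale"
    and reg: "algebra_over_field.regular_grading scale A \<Gamma> \<beta>"
    and min: "minimal_decomposition \<beta>"
  shows "supercommutative scale (\<Gamma> 0) (\<Gamma> 1)"
proof -
  interpret algebra_over_field scale by fact
  note \<beta>0 = regular_commutation_zero[OF reg]
  have two: "x = 0 \<or> x = 1" for x :: 2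
    using UNIV_two by blast
  have "\<beta> 1 1 \<noteq> 1"
  proof
    assume "\<beta> 1 1 = 1"
    then have "\<beta> 0 x = \<beta> 1 x" for x
      using two[of x] \<beta>0 by auto
    moreover have "(0::2) \<noteq> 1" by simp
    ultimately show False
      using min unfolding minimal_decomposition_def by blast
  qed
  moreover have "(\<beta> 1 1)\<^sup>2 = 1"
    using regular_commutation_square[OF reg, of 1] by (simp only: power2_eq_square)
  ultimately have \<beta>1: "\<beta> 1 1 = - 1"
    by (simp add: power2_eq_1_iff)
  have grading: "is_grading A \<Gamma>"
    using reg by (simp only: regular_grading_def)
  have prod: "x * y \<in> \<Gamma> (g + h)" if "x \<in> \<Gamma> g" "y \<in> \<Gamma> h" for x y g h
    using grading that by (simp add: is_grading_def)
  have sub: "subspace (\<Gamma> g)" for g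
    using grading by (simp add: is_grading_def)
  have two0: "(1::2) + 1 = 0" by simp
  show ?thesis
  proof unfold_locales
    fix x y assume "x \<in> \<Gamma> 0" "y \<in> \<Gamma> 0 \<union> \<Gamma> 1"
    then show "x * y = y * x"
      using regular_commute[OF reg, of x 0 y] \<beta>0 by auto
  next
    fix x y assume "x \<in> \<Gamma> 1" "y \<in> \<Gamma> 1"
    then show "x * y = - (y * x)"
      using regular_commute[OF reg, of x 1 y 1] \<beta>1 by (simp add: scale_minus_left)
  next
    fix n
    show "\<exists>ts. set ts \<subseteq> \<Gamma> 1 \<and> length ts = n \<and> prod_list ts \<noteq> 0"
    proof (cases "n = 0")
      case False
      then obtain ts where ts: "list_all2 (\<lambda>g a. a \<in> \<Gamma> g) (replicate n 1) ts" "prod_list ts \<noteq> 0"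
        using regular_product[OF reg, of "replicate n 1"] by auto
      then have "length ts = n" "set ts \<subseteq> \<Gamma> 1"
        by (auto simp: list_all2_conv_all_nth in_set_conv_nth)
      with ts show ?thesis by blast
    qed simp
  next
    fix x y assume "x \<in> \<Gamma> 1" "y \<in> \<Gamma> 1"
    then have "x * y \<in> \<Gamma> (1 + 1)" by (rule prod)
    then show "x * y \<in> \<Gamma> 0" by (simp only: two0)
  qed (use sub prod[of _ 0 _ 0] prod[of _ 0 _ 1] in auto)
qed

theorem theorem32:
  fixes scale :: "'k::{alg_closed_field,field_char_0} \<Rightarrow> 'a::ring_1 \<Rightarrow> 'a"
    and A :: "'a set"
    and \<Gamma> :: "2 \<Rightarrow> 'a set"
    and \<beta> :: "2 \<Rightarrow> 2 \<Rightarrow> 'k"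
  assumes "algebra_over_field scale"
    and "algebra_over_field.subalgebra scale A"
    and "algebra_over_field.regular_grading scale A \<Gamma> \<beta>"
    and "minimal_decomposition \<beta>"
  shows "algebra_over_field.central_primeness_property scale A"
proof -
  interpret algebra_over_field scale by fact
  interpret supercommutative scale "\<Gamma> 0" "\<Gamma> 1"
    using assms(1,3,4) by (rule minimal_regular_supercommutative)
  have grading: "is_grading A \<Gamma>"
    using assms(3) by (simp only: regular_grading_def)
  show ?thesis
  proof (rule central_primeness)
    show "subspace A"
      using assms(2) by (simp only: subalgebra_def)
    show "\<Gamma> 0 \<subseteq> A" "\<Gamma> 1 \<subseteq> A"
      using grading by (simp_all add: is_grading_def)
    fix a assume "a \<in> A"
    then obtain x where x: "\<And>g. x g \<in> \<Gamma> g" "a = (\<Sum>g\<in>UNIV. x g)"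
      using grading unfolding is_grading_def by (elim conjE) (metis (no_types, lifting))
    moreover have "(\<Sum>g\<in>UNIV. x g) = x 0 + x 1"
      by (simp add: UNIV_two)
    ultimately show "\<exists>x\<in>\<Gamma> 0. \<exists>y\<in>\<Gamma> 1. a = x + y"
      by metis
  qed
qed

end
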